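(* Let $G$ be a connected graph, $\mathcal B$ a collection of circuits of $G$, and $T$ any spanning tree of $G$. Then $$\pi_1(G,\mathcal B)\cong\Gamma(G,T,\mathcal B).$$ In particular, the group $\Gamma(G,T,\mathcal B)$ is independent of the spanning tree $T$ up to isomorphism.
   Context: Graphs are simple and undirected, $G=(V,E)$; $a\sim b$ means adjacency; $\vec E$ contains both arcs $xy,yx$ for every edge. A circuit $(x_1,\dots,x_n)$ is a simple closed walk (simple cycle, $n\ge3$); it may be written starting at any of its vertices and in either direction. $\pi_1(G,\mathcal B)$: fix a base vertex $v_*$. A based loop is a map $\phi:\{0,\dots,n\}\to V$ ($n\ge0$) with $\phi(0)=\phi(n)=v_*$ and, for each $i$, $\phi(i)=\phi(i+1)$ or $\phi(i)\sim\phi(i+1)$; its word is $\phi(0),\dots,\phi(n)$. Two loops are equivalent if the word of one can be obtained from that of the other by a finite sequence of the following transformations and their inverses (dots denote unchanged parts): 1. $\dots av_1\dots v_ib\dots\mapsto\dots aw_1\dots w_jb\dots$ where $(a,v_1,\dots,v_i,b,w_j,\dots,w_1)$ is a circuit from $\mathcal B$ ($i,j\ge0$); 2. $\dots aba\dots\mapsto\dots a\dots$ if $a\sim b$; 3. $\dots aa\dots\mapsto\dots a\dots$. $\pi_1(G,\mathcal B)$ is the group of equivalence classes under concatenation. $\Gamma(G,T,\mathcal B)=\langle\vec E\mid T,\mathcal B\rangle$ is the group generated by $\vec E$ with $(xy)=(yx)^{-1}$, subject to the relations that every arc of an edge of $T$ is trivial and that $(x_1x_2)\cdots(x_{n-1}x_n)(x_nx_1)=e$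 for every circuit $(x_1,\dots,x_n)\in\mathcal B$. *)

theory Defs
  imports
    "HOL-Algebra.Coset"
    "Graph_Theory.Digraph_Component"
    "Graph_Theory.Vertex_Walk"
begin

text \<open>
  A simple undirected graph, possibly infinite, is a symmetric loop-free pair digraph
  (\<^locale>\<open>pair_bidirected_digraph\<close>): \<^term>\<open>pverts G\<close> is its vertex set, and \<^term>\<open>parcs G\<close> its set
  of arcs, containing both \<open>(x, y)\<close> and \<open>(y, x)\<close> for every edge.
\<close>

section \<open>Circuits and spanning trees\<close>

definition circuit :: "'a pair_pre_digraph \<Rightarrow> 'a list \<Rightarrow> bool" where
  "circuit G xs \<longleftrightarrow> 3 \<le> length xs \<and> distinct xs \<and> vwalk (xs @ [hd xs]) (with_proj G)"

text \<open>
  A collection of circuits is given by a set of lists, each circuit being written in at least one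
  way. A circuit may be written starting at any of its vertices and in either direction, so
  \<open>circuit_in B xs\<close> says that \<open>xs\<close> is some way of writing a circuit belonging to \<open>B\<close>.
\<close>

definition circuit_in :: "'a list set \<Rightarrow> 'a list \<Rightarrow> bool" where
  "circuit_in B xs \<longleftrightarrow> (\<exists>ys\<in>B. \<exists>k. xs = rotate k ys \<or> xs = rotate k (rev ys))"

text \<open>
  The constants \<^const>\<open>forest\<close> and \<^const>\<open>spanning_tree\<close> of the library are not applicable to
  undirected graphs represented by symmetric digraphs, since they count the closed walk
  \<open>a, b, a\<close> along a single edge as a cycle.
\<close>

definition undirected_spanning_tree :: "'a pair_pre_digraph \<Rightarrow> 'a pair_pre_digraph \<Rightarrow> bool" where
  "undirected_spanning_tree T G \<longleftrightarrow>
     pair_bidirected_digraph T \<and> spanning (with_proj T) (with_proj G) \<and>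
     Digraph_Component.connected (with_proj T) \<and> \<not> (\<exists>xs. circuit T xs)"


section \<open>The fundamental group of a graph with respect to a collection of circuits\<close>

text \<open>A based loop \<open>\<phi> : {0, \<dots>, n} \<rightarrow> V\<close> is represented by its word \<open>[\<phi> 0, \<dots>, \<phi> n]\<close>.\<close>

definition based_loops :: "'a pair_pre_digraph \<Rightarrow> 'a \<Rightarrow> 'a list set" where
  "based_loops G v =
     {p. p \<noteq> [] \<and> set p \<subseteq> pverts G \<and> hd p = v \<and> last p = v \<and>
         successively (\<lambda>a b. a = b \<or> (a, b) \<in> parcs G) p}"

inductive loop_step :: "'a pair_pre_digraph \<Rightarrow> 'a list set \<Rightarrow> 'a list \<Rightarrow> 'a list \<Rightarrow> bool"
  for G B where
  circ: "circuit_in B (a # vs @ b # rev ws) \<Longrightarrow>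
           loop_step G B (p @ a # vs @ b # q) (p @ a # ws @ b # q)"
| backtrack: "(a, b) \<in> parcs G \<Longrightarrow> loop_step G B (p @ [a, b, a] @ q) (p @ [a] @ q)"
| stutter: "loop_step G B (p @ [a, a] @ q) (p @ [a] @ q)"

definition loop_equiv :: "'a pair_pre_digraph \<Rightarrow> 'a list set \<Rightarrow> 'a \<Rightarrow> 'a list rel" where
  "loop_equiv G B v =
     {(p, q). p \<in> based_loops G v \<and> q \<in> based_loops G v \<and> equivclp (loop_step G B) p q}"

text \<open>
  Concatenating loops identifies the end of the first with the start of the second, so on words
  it is \<open>p @ tl q\<close>.
\<close>

definition pi1 :: "'a pair_pre_digraph \<Rightarrow> 'a list set \<Rightarrow> 'a \<Rightarrow> 'a list set monoid" where
  "pi1 G B v =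
     \<lparr> carrier = based_loops G v // loop_equiv G B v,
       monoid.mult = (\<lambda>X Y. \<Union>p\<in>X. \<Union>q\<in>Y. loop_equiv G B v `` {p @ tl q}),
       one = loop_equiv G B v `` {[v]} \<rparr>"


section \<open>Groups given by generators and relations\<close>

text \<open>
  The letter \<open>(True, x)\<close> stands for the generator \<open>x\<close>, and \<open>(False, x)\<close> for its formal inverse.
\<close>

type_synonym 'g word = "(bool \<times> 'g) list"

inductive cancel_step :: "'g set \<Rightarrow> 'g word \<Rightarrow> 'g word \<Rightarrow> bool" for S where
  "x \<in> S \<Longrightarrow> cancel_step S (p @ [(e, x), (\<not> e, x)] @ q) (p @ q)"

definition word_equiv :: "'g set \<Rightarrow> 'g word rel" where
  "word_equiv S =
     {(u, w). u \<in> lists (UNIV \<times> S) \<and> w \<in> lists (UNIV \<times> S) \<and> equivclp (cancel_step S) u w}"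

definition free_group :: "'g set \<Rightarrow> 'g word set monoid" where
  "free_group S =
     \<lparr> carrier = lists (UNIV \<times> S) // word_equiv S,
       monoid.mult = (\<lambda>X Y. \<Union>u\<in>X. \<Union>w\<in>Y. word_equiv S `` {u @ w}),
       one = word_equiv S `` {[]} \<rparr>"

definition normal_closure :: "('g, 'm) monoid_scheme \<Rightarrow> 'g set \<Rightarrow> 'g set" where
  "normal_closure F R = \<Inter>{N. N \<lhd> F \<and> R \<subseteq> N}"

definition presented_group :: "'g set \<Rightarrow> 'g word set \<Rightarrow> 'g word set set monoid" where
  "presented_group S R =
     free_group S Mod normal_closure (free_group S) ((\<lambda>w. word_equiv S `` {w}) ` R)"

text \<open>
  The relation \<open>(xy) = (yx)\<^sup>-\<^sup>1\<close> is imposed by the relator \<open>(xy)(yx)\<close>. For a circuit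
  \<open>xs = [x\<^sub>1, \<dots>, x\<^sub>n]\<close>, \<^term>\<open>vwalk_arcs (xs @ [hd xs])\<close> is
  \<open>[(x\<^sub>1, x\<^sub>2), \<dots>, (x\<^sub>n, x\<^sub>1)]\<close>.
\<close>

definition Gamma_relators ::
  "'a pair_pre_digraph \<Rightarrow> 'a pair_pre_digraph \<Rightarrow> 'a list set \<Rightarrow> ('a \<times> 'a) word set" where
  "Gamma_relators G T B =
     {[(True, (x, y)), (True, (y, x))] | x y. (x, y) \<in> parcs G} \<union>
     {[(True, a)] | a. a \<in> parcs T} \<union>
     {map (Pair True) (vwalk_arcs (xs @ [hd xs])) | xs. circuit_in B xs}"

definition Gamma ::
  "'a pair_pre_digraph \<Rightarrow> 'a pair_pre_digraph \<Rightarrow> 'a list set \<Rightarrow> ('a \<times> 'a) word set set monoid" where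
  "Gamma G T B = presented_group (parcs G) (Gamma_relators G T B)"


section \<open>These structures are groups\<close>

lemma equivclp_lift:
  assumes "equivclp r x y" and "\<And>x y. r x y \<Longrightarrow> s (f x) (f y)"
  shows "equivclp s (f x) (f y)"
  using assms(1)
proof (induction rule: equivclp_induct)
  case (step y z)
  then show ?case
    using assms(2) by (meson equivclp_sym equivclp_trans r_into_equivclp)
qed simp

lemma cancel_step_append:
  assumes "cancel_step S u w" shows "cancel_step S (p @ u @ q) (p @ w @ q)"
  using assms
proof cases
  case (1 x p' e q')
  then show ?thesis
    using cancel_step.intros[of x S "p @ p'" e "q' @ q"] by simp
qed

lemma equiv_word_equiv: "equiv (lists (UNIV \<times> S)) (word_equiv S)"
  by (rule equivI)
    (auto simp: word_equiv_def refl_on_def sym_def trans_def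
      intro: equivclp_sym equivclp_trans)

lemma word_equiv_append:
  assumes "(u, u') \<in> word_equiv S" "(w, w') \<in> word_equiv S"
  shows "(u @ w, u' @ w') \<in> word_equiv S"
proof -
  have "equivclp (cancel_step S) (u @ w) (u' @ w)"
    by (rule equivclp_lift[where f = "\<lambda>x. x @ w" and r = "cancel_step S"])
      (use assms(1) cancel_step_append[of S _ _ "[]" w] in \<open>auto simp: word_equiv_def\<close>)
  moreover have "equivclp (cancel_step S) (u' @ w) (u' @ w')"
    by (rule equivclp_lift[where f = "\<lambda>x. u' @ x" and r = "cancel_step S"])
      (use assms(2) cancel_step_append[of S _ _ "u'" "[]"] in \<open>auto simp: word_equiv_def\<close>)
  ultimately show ?thesis
    using assms by (auto simp: word_equiv_def intro: equivclp_trans)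
qed

lemma free_group_mult:
  assumes "u \<in> lists (UNIV \<times> S)" "w \<in> lists (UNIV \<times> S)"
  shows "word_equiv S `` {u} \<otimes>\<^bsub>free_group S\<^esub> word_equiv S `` {w} = word_equiv S `` {u @ w}"
  unfolding free_group_def monoid.simps
  by (rule UN_equiv_class2[OF equiv_word_equiv equiv_word_equiv])
    (use assms in \<open>auto simp: congruent2_def
       intro!: equiv_class_eq[OF equiv_word_equiv] word_equiv_append\<close>)

lemma word_equiv_inverse:
  assumes "w \<in> lists (UNIV \<times> S)"
  shows "(rev (map (apfst Not) w) @ w, []) \<in> word_equiv S"
  using assms
proof (induction w)
  case Nil
  then show ?case by (simp add: word_equiv_def)
next
  case (Cons l w)
  obtain e x where l: "l = (e, x)" by (cases l)
  have x: "x \<in> S" using Cons.hyps by (simp add: l Cons_in_lists_iff)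
  let ?v = "rev (map (apfst Not) w)"
  have "cancel_step S (?v @ [(\<not> e, x), (\<not> \<not> e, x)] @ w) (?v @ w)"
    by (rule cancel_step.intros[OF x])
  then have "(?v @ [(\<not> e, x), (e, x)] @ w, ?v @ w) \<in> word_equiv S"
    using Cons.hyps x by (fastforce simp: word_equiv_def lists_eq_set)
  moreover have "(?v @ w, []) \<in> word_equiv S"
    by (rule Cons.IH)
  ultimately show ?case
    using equiv_word_equiv[of S] by (simp add: l) (meson equivE transD)
qed

lemma group_free_group: "group (free_group S)"
proof (rule groupI)
  let ?c = "\<lambda>w. word_equiv S `` {w}"
  have one: "\<one>\<^bsub>free_group S\<^esub> = ?c []" by (simp add: free_group_def)
  have mem: "?c w \<in> carrier (free_group S)" if "w \<in> lists (UNIV \<times> S)" for w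
    using that by (simp add: free_group_def quotientI)
  have car: "\<exists>w\<in>lists (UNIV \<times> S). X = ?c w" if "X \<in> carrier (free_group S)" for X
    using that by (auto simp: free_group_def elim: quotientE)
  show "X \<otimes>\<^bsub>free_group S\<^esub> Y \<in> carrier (free_group S)"
    if XY: "X \<in> carrier (free_group S)" "Y \<in> carrier (free_group S)" for X Y
  proof -
    obtain u w where "u \<in> lists (UNIV \<times> S)" "X = ?c u" "w \<in> lists (UNIV \<times> S)" "Y = ?c w"
      using car[OF XY(1)] car[OF XY(2)] by blast
    then show ?thesis using mem[of "u @ w"] by (simp add: free_group_mult)
  qed
  show "\<one>\<^bsub>free_group S\<^esub> \<in> carrier (free_group S)"
    using mem[of "[]"] by (simp add: one)
  show "X \<otimes>\<^bsub>free_group S\<^esub> Y \<otimes>\<^bsub>free_group S\<^esub> Z = X \<otimes>\<^bsub>free_group S\<^esub> (Y \<otimes>\<^bsub>free_group S\<^esub> Z)"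
    if XYZ: "X \<in> carrier (free_group S)" "Y \<in> carrier (free_group S)" "Z \<in> carrier (free_group S)"
    for X Y Z
  proof -
    obtain u w z where "u \<in> lists (UNIV \<times> S)" "X = ?c u" "w \<in> lists (UNIV \<times> S)" "Y = ?c w"
      "z \<in> lists (UNIV \<times> S)" "Z = ?c z"
      using car[OF XYZ(1)] car[OF XYZ(2)] car[OF XYZ(3)] by blast
    then show ?thesis by (simp add: free_group_mult)
  qed
  show "\<one>\<^bsub>free_group S\<^esub> \<otimes>\<^bsub>free_group S\<^esub> X = X" if "X \<in> carrier (free_group S)" for X
    using car[OF that] free_group_mult[of "[]" S] by (auto simp: one)
  show "\<exists>Y\<in>carrier (free_group S). Y \<otimes>\<^bsub>free_group S\<^esub> X = \<one>\<^bsub>free_group S\<^esub>"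
    if X: "X \<in> carrier (free_group S)" for X
  proof -
    obtain w where w: "w \<in> lists (UNIV \<times> S)" "X = ?c w" using car[OF X] by blast
    let ?v = "rev (map (apfst Not) w)"
    have v: "?v \<in> lists (UNIV \<times> S)" using w(1) by (fastforce simp: lists_eq_set)
    have "?c ?v \<otimes>\<^bsub>free_group S\<^esub> X = \<one>\<^bsub>free_group S\<^esub>"
      unfolding w(2) free_group_mult[OF v w(1)] one
      by (rule equiv_class_eq[OF equiv_word_equiv word_equiv_inverse[OF w(1)]])
    then show ?thesis using mem[OF v] by blast
  qed
qed

lemma (in group) normal_closure_normal:
  assumes "R \<subseteq> carrier G" shows "normal_closure G R \<lhd> G"
proof -
  let ?C = "{N. N \<lhd> G \<and> R \<subseteq> N}"
  have "carrier G \<lhd> G" by (rule normal_invI) (auto simp: subgroup_self)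
  then have ne: "?C \<noteq> {}" using assms by blast
  have sub: "subgroup (\<Inter>?C) G"
    by (rule subgroups_Inter) (use ne in \<open>auto simp: normal_def\<close>)
  show ?thesis
    unfolding normal_closure_def
    by (rule normal_invI[OF sub]) (auto intro: normal.inv_op_closed2)
qed

lemma group_presented_group:
  assumes "R \<subseteq> lists (UNIV \<times> S)" shows "group (presented_group S R)"
proof -
  interpret F: group "free_group S" by (rule group_free_group)
  have "(\<lambda>w. word_equiv S `` {w}) ` R \<subseteq> carrier (free_group S)"
    using assms by (auto simp: free_group_def intro: quotientI)
  then show ?thesis
    unfolding presented_group_def
    by (intro normal.factorgroup_is_group F.normal_closure_normal)
qed

lemma parcs_sym:
  assumes "pair_bidirected_digraph G" "(a, b) \<in> parcs G" shows "(b, a) \<in> parcs G"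
proof -
  interpret pair_bidirected_digraph G by fact
  show ?thesis using pair_sym_arcs assms(2) by (auto simp: symmetric_def dest: symD)
qed

lemma circuit_rotate1:
  assumes "circuit G xs" shows "circuit G (rotate1 xs)"
proof (cases xs)
  case (Cons x ys)
  then have "ys \<noteq> []" using assms by (auto simp: circuit_def)
  then show ?thesis
    using assms Cons by (auto simp: circuit_def vwalk_def vwalk_arcs_append)
qed (use assms in simp)

lemma circuit_rotate:
  assumes "circuit G xs" shows "circuit G (rotate k xs)"
  using assms by (induction k) (auto intro: circuit_rotate1)

lemma set_vwalk_arcs_rev: "set (vwalk_arcs (rev xs)) = (set (vwalk_arcs xs))\<inverse>"
proof (induction xs rule: vwalk_arcs.induct)
  case (3 x y xs)
  have "vwalk_arcs (rev (x # y # xs)) = vwalk_arcs (rev (y # xs)) @ [(y, x)]"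
    using vwalk_arcs_append[of "rev (y # xs)" "[x]"] by simp
  then show ?case using 3 by auto
qed auto

lemma circuit_rev:
  assumes "pair_bidirected_digraph G" and xs: "circuit G xs" shows "circuit G (rev xs)"
proof -
  from xs obtain x ys where c: "xs = x # ys" by (cases xs) (auto simp: circuit_def)
  have "set (vwalk_arcs (rev (xs @ [x]))) \<subseteq> parcs G"
    unfolding set_vwalk_arcs_rev
    using xs c by (auto simp: circuit_def vwalk_def intro: parcs_sym[OF assms(1)])
  then have "circuit G (x # rev ys)"
    using xs c by (auto simp: circuit_def vwalk_def)
  then have "circuit G (rotate1 (x # rev ys))" by (rule circuit_rotate1)
  then show ?thesis by (simp add: c)
qed

lemma circuit_circuit_in:
  assumes "pair_bidirected_digraph G" "\<forall>xs\<in>B. circuit G xs" "circuit_in B xs"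
  shows "circuit G xs"
  using assms by (auto simp: circuit_in_def intro: circuit_rotate circuit_rev)

lemma group_Gamma:
  assumes "pair_bidirected_digraph G" "\<forall>xs\<in>B. circuit G xs" "undirected_spanning_tree T G"
  shows "group (Gamma G T B)"
  unfolding Gamma_def
proof (rule group_presented_group)
  have "set (vwalk_arcs (xs @ [hd xs])) \<subseteq> parcs G" if "circuit_in B xs" for xs
    using circuit_circuit_in[OF assms(1,2) that] by (simp add: circuit_def vwalk_def)
  moreover have "parcs T \<subseteq> parcs G"
    using assms(3) by (simp add: undirected_spanning_tree_def spanning_def subgraph_def)
  ultimately show "Gamma_relators G T B \<subseteq> lists (UNIV \<times> parcs G)"
    using parcs_sym[OF assms(1)] by (fastforce simp: Gamma_relators_def)
qed

lemma loop_step_append: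
  assumes "loop_step G B u w" shows "loop_step G B (p @ u @ q) (p @ w @ q)"
  using assms
proof cases
  case (circ a vs b ws p' q')
  then show ?thesis
    using loop_step.circ[of B a vs b ws G "p @ p'" "q' @ q"] by simp
next
  case (backtrack a b p' q')
  then show ?thesis
    using loop_step.backtrack[of a b G B "p @ p'" "q' @ q"] by simp
next
  case (stutter p' a q')
  then show ?thesis
    using loop_step.stutter[of G B "p @ p'" a "q' @ q"] by simp
qed

lemma equiv_loop_equiv: "equiv (based_loops G v) (loop_equiv G B v)"
  by (rule equivI)
    (auto simp: loop_equiv_def refl_on_def sym_def trans_def
      intro: equivclp_sym equivclp_trans)

lemma based_loops_concat_eq:
  assumes "p \<in> based_loops G v" "q \<in> based_loops G v"
  shows "p @ tl q = butlast p @ q"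
proof -
  have "butlast p @ [v] = p" "v # tl q = q"
    using assms append_butlast_last_id[of p] hd_Cons_tl[of q] by (auto simp: based_loops_def)
  then show ?thesis by (metis append.assoc append_Cons append_Nil)
qed

lemma based_loops_concat:
  assumes p: "p \<in> based_loops G v" and q: "q \<in> based_loops G v"
  shows "p @ tl q \<in> based_loops G v"
proof -
  obtain q' where q': "q = v # q'"
    using q by (cases q) (auto simp: based_loops_def)
  show ?thesis
    using p q by (cases q') (auto simp: q' based_loops_def successively_append_iff)
qed

lemma loop_equiv_concat:
  assumes p: "(p, p') \<in> loop_equiv G B v" and q: "(q, q') \<in> loop_equiv G B v"
  shows "(p @ tl q, p' @ tl q') \<in> loop_equiv G B v"
proof -
  have L: "p \<in> based_loops G v" "p' \<in> based_loops G v" "q \<in> based_loops G v" "q' \<in> based_loops G v"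
    using p q by (auto simp: loop_equiv_def)
  have "equivclp (loop_step G B) (p @ tl q) (p' @ tl q)"
    by (rule equivclp_lift[where f = "\<lambda>x. x @ tl q" and r = "loop_step G B"])
      (use p loop_step_append[of G B _ _ "[]" "tl q"] in \<open>auto simp: loop_equiv_def\<close>)
  moreover have "equivclp (loop_step G B) (butlast p' @ q) (butlast p' @ q')"
    by (rule equivclp_lift[where f = "\<lambda>x. butlast p' @ x" and r = "loop_step G B"])
      (use q loop_step_append[of G B _ _ "butlast p'" "[]"] in \<open>auto simp: loop_equiv_def\<close>)
  ultimately have "equivclp (loop_step G B) (p @ tl q) (p' @ tl q')"
    using L by (metis based_loops_concat_eq equivclp_trans)
  then show ?thesis
    using L by (simp add: loop_equiv_def based_loops_concat)
qed

lemma pi1_mult: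
  assumes "p \<in> based_loops G v" "q \<in> based_loops G v"
  shows "loop_equiv G B v `` {p} \<otimes>\<^bsub>pi1 G B v\<^esub> loop_equiv G B v `` {q} =
         loop_equiv G B v `` {p @ tl q}"
  unfolding pi1_def monoid.simps
  by (rule UN_equiv_class2[OF equiv_loop_equiv equiv_loop_equiv])
    (use assms in \<open>auto simp: congruent2_def
       intro!: equiv_class_eq[OF equiv_loop_equiv] loop_equiv_concat\<close>)

lemma based_loops_rev:
  assumes "pair_bidirected_digraph G" and p: "p \<in> based_loops G v"
  shows "rev p \<in> based_loops G v"
proof -
  have "successively (\<lambda>a b. b = a \<or> (b, a) \<in> parcs G) p"
    by (rule successively_mono[where P = "\<lambda>a b. a = b \<or> (a, b) \<in> parcs G"])
      (use p parcs_sym[OF assms(1)] in \<open>auto simp: based_loops_def\<close>)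
  then show ?thesis using p by (simp add: based_loops_def hd_rev last_rev)
qed

lemma equivclp_rev_walk:
  assumes "pair_bidirected_digraph G" and "p \<noteq> []"
    and "successively (\<lambda>a b. a = b \<or> (a, b) \<in> parcs G) p"
  shows "equivclp (loop_step G B) (rev p @ tl p) [last p]"
  using assms(2,3)
proof (induction p)
  case (Cons a ys)
  show ?case
  proof (cases ys)
    case Nil
    then show ?thesis by simp
  next
    case ys: (Cons b zs)
    have IH: "equivclp (loop_step G B) (rev zs @ [b] @ zs) [last (a # ys)]"
      using Cons by (simp add: ys)
    have "equivclp (loop_step G B) (rev zs @ [b, a, b] @ zs) (rev zs @ [b] @ zs)"
    proof (cases "a = b")
      case True
      then show ?thesis
        using loop_step.stutter[of G B "rev zs" b "b # zs"] loop_step.stutter[of G B "rev zs" b zs]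
        by (auto intro: equivclp_trans r_into_equivclp)
    next
      case False
      then have "(b, a) \<in> parcs G" using Cons.prems parcs_sym[OF assms(1)] by (auto simp: ys)
      then show ?thesis by (intro r_into_equivclp loop_step.backtrack)
    qed
    then have "equivclp (loop_step G B) (rev zs @ [b, a, b] @ zs) [last (a # ys)]"
      using IH by (rule equivclp_trans)
    then show ?thesis by (simp add: ys)
  qed
qed simp

lemma group_pi1:
  assumes G: "pair_bidirected_digraph G" and v: "v \<in> pverts G"
  shows "group (pi1 G B v)"
proof (rule groupI)
  let ?c = "\<lambda>p. loop_equiv G B v `` {p}"
  have one: "\<one>\<^bsub>pi1 G B v\<^esub> = ?c [v]" by (simp add: pi1_def)
  have triv: "[v] \<in> based_loops G v" using v by (simp add: based_loops_def)
  have mem: "?c p \<in> carrier (pi1 G B v)" if "p \<in> based_loops G v" for p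
    using that by (simp add: pi1_def quotientI)
  have car: "\<exists>p\<in>based_loops G v. X = ?c p" if "X \<in> carrier (pi1 G B v)" for X
    using that by (auto simp: pi1_def elim: quotientE)
  show "X \<otimes>\<^bsub>pi1 G B v\<^esub> Y \<in> carrier (pi1 G B v)"
    if XY: "X \<in> carrier (pi1 G B v)" "Y \<in> carrier (pi1 G B v)" for X Y
  proof -
    obtain p q where "p \<in> based_loops G v" "X = ?c p" "q \<in> based_loops G v" "Y = ?c q"
      using car[OF XY(1)] car[OF XY(2)] by blast
    then show ?thesis by (simp add: pi1_mult mem based_loops_concat)
  qed
  show "\<one>\<^bsub>pi1 G B v\<^esub> \<in> carrier (pi1 G B v)"
    using mem[OF triv] by (simp add: one)
  show "X \<otimes>\<^bsub>pi1 G B v\<^esub> Y \<otimes>\<^bsub>pi1 G B v\<^esub> Z = X \<otimes>\<^bsub>pi1 G B v\<^esub> (Y \<otimes>\<^bsub>pi1 G B v\<^esub> Z)"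
    if XYZ: "X \<in> carrier (pi1 G B v)" "Y \<in> carrier (pi1 G B v)" "Z \<in> carrier (pi1 G B v)"
    for X Y Z
  proof -
    obtain p q r where pqr: "p \<in> based_loops G v" "X = ?c p" "q \<in> based_loops G v" "Y = ?c q"
      "r \<in> based_loops G v" "Z = ?c r"
      using car[OF XYZ(1)] car[OF XYZ(2)] car[OF XYZ(3)] by blast
    moreover have "q \<noteq> []" using pqr(3) by (simp add: based_loops_def)
    ultimately show ?thesis by (simp add: pi1_mult based_loops_concat)
  qed
  show "\<one>\<^bsub>pi1 G B v\<^esub> \<otimes>\<^bsub>pi1 G B v\<^esub> X = X" if X: "X \<in> carrier (pi1 G B v)" for X
  proof -
    obtain p where p: "p \<in> based_loops G v" "X = ?c p" using car[OF X] by blast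
    have "[v] @ tl p = p" using p(1) by (cases p) (auto simp: based_loops_def)
    then show ?thesis using pi1_mult[OF triv p(1), of B] by (simp add: p(2) one)
  qed
  show "\<exists>Y\<in>carrier (pi1 G B v). Y \<otimes>\<^bsub>pi1 G B v\<^esub> X = \<one>\<^bsub>pi1 G B v\<^esub>"
    if X: "X \<in> carrier (pi1 G B v)" for X
  proof -
    obtain p where p: "p \<in> based_loops G v" "X = ?c p" using car[OF X] by blast
    note r = based_loops_rev[OF G p(1)]
    have "equivclp (loop_step G B) (rev p @ tl p) [v]"
      using equivclp_rev_walk[OF G, of p B] p(1) by (simp add: based_loops_def)
    then have "(rev p @ tl p, [v]) \<in> loop_equiv G B v"
      using triv based_loops_concat[OF r p(1)] by (simp add: loop_equiv_def)
    then have "?c (rev p) \<otimes>\<^bsub>pi1 G B v\<^esub> X = \<one>\<^bsub>pi1 G B v\<^esub>"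
      unfolding p(2) pi1_mult[OF r p(1)] one by (rule equiv_class_eq[OF equiv_loop_equiv])
    then show ?thesis using mem[OF r] by blast
  qed
qed

end

theory Submission
  imports Defs
begin

text \<open>
  For each vertex \<open>x\<close> choose a walk \<open>t\<^sub>x\<close> from the base vertex \<open>v\<close> to \<open>x\<close> inside the spanning tree
  \<open>T\<close>. Two homomorphisms, inverse to each other, connect the two groups.

  From \<open>\<Gamma>\<close> to \<open>\<pi>\<^sub>1\<close>, send the generator \<open>xy\<close> to the class of the loop that runs along \<open>t\<^sub>x\<close>, crosses
  the arc \<open>xy\<close> and returns along \<open>t\<^sub>y\<close>. By the universal property of the presentation
  (\<open>presented_group_universal\<close>) the relators have to become trivial (\<open>relator_val\<close>). More generally,
  in the product of such loops along a walk the inner tree walks cancel, so the product is the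
  class of the \<^emph>\<open>lasso\<close> that reaches the beginning of the walk through the tree, follows
  the walk and returns from its end through the tree (\<open>lasso_Cons\<close>). A walk \<open>x, y, x\<close> and
  a walk around a circuit of \<open>B\<close> both contract to a vertex. For an arc of \<open>T\<close> the lasso is a closed
  walk in \<open>T\<close>, and this is where the absence of circuits is used: a walk that visits a vertex
  twice contains a repeated letter, a backtracking or a circuit. Hence a closed walk
  in a tree can be shortened until only one vertex remains (\<open>closed_tree_walk_null\<close>).

  From \<open>\<pi>\<^sub>1\<close> to \<open>\<Gamma>\<close>, send a loop to the product of the arcs that it crosses. Each of the three
  transformations of loops preserves this product, because \<open>(xy)(yx) = 1\<close> and the product
  around each circuit of \<open>B\<close> is trivial (\<open>walk_prod_loop_step\<close>).

  Starting from a generator \<open>xy\<close>, one comes back to the product along its lasso, which is \<open>xy\<close>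
  because the arcs of \<open>T\<close> are trivial in \<open>\<Gamma>\<close> (\<open>walk_prod_lasso\<close>). Starting from a loop, one
  comes back to its lasso, which is the same loop up to a closed tree walk at either end
  (\<open>lasso_loop\<close>). Independence of \<open>T\<close> follows, as \<open>\<pi>\<^sub>1\<close> does not involve \<open>T\<close>.
\<close>

section \<open>The universal property of a presentation\<close>

text \<open>
  The image of a word under the homomorphism from the free group to \<open>H\<close> that extends \<open>f\<close>.
\<close>

fun word_val :: "('h, 'm) monoid_scheme \<Rightarrow> ('g \<Rightarrow> 'h) \<Rightarrow> 'g word \<Rightarrow> 'h" where
  "word_val H f [] = \<one>\<^bsub>H\<^esub>"
| "word_val H f ((e, x) # w) = (if e then f x else inv\<^bsub>H\<^esub> f x) \<otimes>\<^bsub>H\<^esub> word_val H f w"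

lemma word_val_cong:
  assumes "\<And>x. x \<in> S \<Longrightarrow> f x = f' x" "w \<in> lists (UNIV \<times> S)"
  shows "word_val H f w = word_val H f' w"
  using assms(2) by (induction w) (auto simp: assms(1))

context group
begin

lemma word_val_closed:
  assumes "f \<in> S \<rightarrow> carrier G" "w \<in> lists (UNIV \<times> S)"
  shows "word_val G f w \<in> carrier G"
  using assms(2)
proof (induction w)
  case (Cons l w)
  then show ?case using assms(1) by (cases l) (auto simp: Pi_iff)
qed simp

lemma word_val_append:
  assumes "f \<in> S \<rightarrow> carrier G" "u \<in> lists (UNIV \<times> S)" "w \<in> lists (UNIV \<times> S)"
  shows "word_val G f (u @ w) = word_val G f u \<otimes> word_val G f w"
  using assms(2)
proof (induction u)
  case Nil
  then show ?case using word_val_closed[OF assms(1,3)] by simp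
next
  case (Cons l u)
  then show ?case
    using assms(1) word_val_closed[OF assms(1,3)] word_val_closed[OF assms(1), of u]
    by (cases l) (auto simp: Pi_iff m_assoc)
qed

text \<open>
  Outside \<open>S\<close> the values of \<open>f\<close> need not be group elements, so the evaluation of a word is under
  control only as long as all its letters lie in \<open>S\<close>. An equivalence of words uses cancellations in
  both directions, hence membership in \<open>lists (UNIV \<times> S)\<close> has to be preserved in both directions.
\<close>

lemma word_val_cancel_step:
  assumes f: "f \<in> S \<rightarrow> carrier G" and "cancel_step S u w"
  shows "(u \<in> lists (UNIV \<times> S) \<longleftrightarrow> w \<in> lists (UNIV \<times> S)) \<and>
         (u \<in> lists (UNIV \<times> S) \<longrightarrow> word_val G f u = word_val G f w)"
  using assms(2)
proof cases
  case (1 x p e q)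
  have "word_val G f u = word_val G f w" if "p \<in> lists (UNIV \<times> S)" "q \<in> lists (UNIV \<times> S)"
  proof -
    have x: "f x \<in> carrier G" using 1 f by (auto simp: Pi_iff)
    have "[(e, x), (\<not> e, x)] \<in> lists (UNIV \<times> S)" using 1 by simp
    then have "word_val G f ([(e, x), (\<not> e, x)] @ q) = word_val G f q"
      using word_val_append[OF f _ that(2)] word_val_closed[OF f that(2)] x
      by (cases e) (simp_all del: m_assoc flip: m_assoc)
    then show ?thesis
      using that 1 word_val_append[OF f that(1), of "[(e, x), (\<not> e, x)] @ q"]
        word_val_append[OF f that(1), of q] by simp
  qed
  then show ?thesis using 1 by auto
qed

lemma word_val_word_equiv:
  assumes "f \<in> S \<rightarrow> carrier G" and uw: "(u, w) \<in> word_equiv S"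
  shows "word_val G f u = word_val G f w"
proof -
  have "equivclp (cancel_step S) u w" "u \<in> lists (UNIV \<times> S)"
    using uw by (auto simp: word_equiv_def)
  then have "w \<in> lists (UNIV \<times> S) \<and> word_val G f u = word_val G f w"
  proof (induction rule: equivclp_induct)
    case (step y z)
    then show ?case using word_val_cancel_step[OF assms(1)] by metis
  qed simp
  then show ?thesis by simp
qed

end

lemma free_group_universal:
  assumes "group H" and f: "f \<in> S \<rightarrow> carrier H"
  obtains h where "h \<in> hom (free_group S) H"
    and "\<And>w. w \<in> lists (UNIV \<times> S) \<Longrightarrow> h (word_equiv S `` {w}) = word_val H f w"
proof -
  interpret H: group H by fact
  define h where "h X = word_val H f (SOME w. w \<in> X)" for X
  have h: "h (word_equiv S `` {w}) = word_val H f w" if w: "w \<in> lists (UNIV \<times> S)" for w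
  proof -
    have "w \<in> word_equiv S `` {w}" using equiv_class_self[OF equiv_word_equiv w] .
    then have "(w, SOME u. u \<in> word_equiv S `` {w}) \<in> word_equiv S"
      using someI[of "\<lambda>u. u \<in> word_equiv S `` {w}" w] by simp
    then show ?thesis unfolding h_def by (rule H.word_val_word_equiv[OF f, symmetric])
  qed
  have "h \<in> hom (free_group S) H"
  proof (rule homI)
    fix X assume "X \<in> carrier (free_group S)"
    then obtain w where "w \<in> lists (UNIV \<times> S)" "X = word_equiv S `` {w}"
      by (auto simp: free_group_def elim!: quotientE)
    then show "h X \<in> carrier H" by (simp add: h H.word_val_closed[OF f])
  next
    fix X Y assume "X \<in> carrier (free_group S)" "Y \<in> carrier (free_group S)"
    then obtain u w where "u \<in> lists (UNIV \<times> S)" "X = word_equiv S `` {u}"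
      "w \<in> lists (UNIV \<times> S)" "Y = word_equiv S `` {w}"
      by (auto simp: free_group_def elim!: quotientE)
    then show "h (X \<otimes>\<^bsub>free_group S\<^esub> Y) = h X \<otimes>\<^bsub>H\<^esub> h Y"
      by (simp add: free_group_mult h H.word_val_append[OF f])
  qed
  then show thesis using h that by blast
qed

text \<open>
  The element of the presented group represented by a word. The group is a quotient of a quotient:
  the word is taken first modulo cancellation and then modulo the normal closure of the relators.
\<close>

definition pres_class :: "'g set \<Rightarrow> 'g word set \<Rightarrow> 'g word \<Rightarrow> 'g word set set" where
  "pres_class S R w =
     normal_closure (free_group S) ((\<lambda>w. word_equiv S `` {w}) ` R)
       #>\<^bsub>free_group S\<^esub> (word_equiv S `` {w})"

locale presentation =
  fixes S :: "'g set" and R :: "'g word set"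
  assumes relators: "R \<subseteq> lists (UNIV \<times> S)"
begin

abbreviation N where
  "N \<equiv> normal_closure (free_group S) ((\<lambda>w. word_equiv S `` {w}) ` R)"

lemma class_in_free_group: "w \<in> lists (UNIV \<times> S) \<Longrightarrow> word_equiv S `` {w} \<in> carrier (free_group S)"
  by (simp add: free_group_def quotientI)

lemma normal_N: "N \<lhd> free_group S"
  by (rule group.normal_closure_normal[OF group_free_group])
    (use relators class_in_free_group in blast)

lemma carrier_presented_group:
  "carrier (presented_group S R) = pres_class S R ` lists (UNIV \<times> S)"
proof -
  have "carrier (free_group S) = (\<lambda>w. word_equiv S `` {w}) ` lists (UNIV \<times> S)"
    by (auto simp: free_group_def quotient_def)
  then show ?thesis
    by (auto simp: presented_group_def FactGroup_def RCOSETS_def pres_class_def)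
qed

lemma pres_class_mult:
  assumes "u \<in> lists (UNIV \<times> S)" "w \<in> lists (UNIV \<times> S)"
  shows "pres_class S R u \<otimes>\<^bsub>presented_group S R\<^esub> pres_class S R w = pres_class S R (u @ w)"
  using normal.rcos_sum[OF normal_N class_in_free_group[OF assms(1)] class_in_free_group[OF assms(2)]]
  by (simp add: presented_group_def FactGroup_def pres_class_def free_group_mult[OF assms])

lemma pres_class_Nil: "pres_class S R [] = \<one>\<^bsub>presented_group S R\<^esub>"
proof -
  interpret normal N "free_group S" by (rule normal_N)
  have "word_equiv S `` {[]} = \<one>\<^bsub>free_group S\<^esub>" by (simp add: free_group_def)
  then show ?thesis
    using coset_mult_one[OF subset] by (simp add: presented_group_def FactGroup_def pres_class_def)
qed

lemma pres_class_relator: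
  assumes "r \<in> R" shows "pres_class S R r = \<one>\<^bsub>presented_group S R\<^esub>"
proof -
  interpret normal N "free_group S" by (rule normal_N)
  have "word_equiv S `` {r} \<in> N" using assms by (auto simp: normal_closure_def)
  then show ?thesis
    using coset_join2[OF _ subgroup_axioms] relators assms class_in_free_group
    by (auto simp: presented_group_def FactGroup_def pres_class_def)
qed

lemma pres_class_inverse_letter:
  assumes "x \<in> S"
  shows "pres_class S R [(False, x)] = inv\<^bsub>presented_group S R\<^esub> pres_class S R [(True, x)]"
proof -
  interpret P: group "presented_group S R" by (rule group_presented_group[OF relators])
  have L: "[(True, x)] \<in> lists (UNIV \<times> S)" "[(False, x)] \<in> lists (UNIV \<times> S)" using assms by auto
  have "cancel_step S [(False, x), (True, x)] []"
    using cancel_step.intros[OF assms, of "[]" False "[]"] by simp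
  then have "([(False, x), (True, x)], []) \<in> word_equiv S"
    using L by (auto simp: word_equiv_def)
  then have "pres_class S R [(False, x), (True, x)] = pres_class S R []"
    unfolding pres_class_def using equiv_class_eq[OF equiv_word_equiv] by metis
  then show ?thesis
    using pres_class_mult[OF L(2,1)] L
    by (intro P.inv_equality[symmetric]) (auto simp: pres_class_Nil carrier_presented_group)
qed

text \<open>
  A homomorphism on a presented group is determined by its values on the generators. In particular,
  an endomorphism that fixes the generators is the identity.
\<close>

lemma hom_pres_class:
  assumes "group H" and h: "h \<in> hom (presented_group S R) H" and "w \<in> lists (UNIV \<times> S)"
  shows "h (pres_class S R w) = word_val H (\<lambda>x. h (pres_class S R [(True, x)])) w"
proof -
  interpret group_hom "presented_group S R" H h
    using assms(1) group_presented_group[OF relators] h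
    by (simp add: group_hom_def group_hom_axioms_def)
  show ?thesis using assms(3)
  proof (induction w)
    case Nil
    then show ?case by (simp add: pres_class_Nil)
  next
    case (Cons l w)
    obtain e x where l: "l = (e, x)" by (cases l)
    have x: "x \<in> S" using Cons.hyps l by simp
    have L: "[(b, x)] \<in> lists (UNIV \<times> S)" for b using x by simp
    have "h (pres_class S R (l # w)) = h (pres_class S R [l]) \<otimes>\<^bsub>H\<^esub> h (pres_class S R w)"
      using pres_class_mult[OF L[of e] Cons.hyps(2)] L Cons.hyps(2) l
      by (metis append_Cons append_Nil carrier_presented_group hom_mult imageI)
    moreover have "pres_class S R [(True, x)] \<in> carrier (presented_group S R)"
      using L by (simp add: carrier_presented_group)
    ultimately show ?case
      using Cons.IH by (cases e) (simp_all add: l pres_class_inverse_letter[OF x])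
  qed
qed

text \<open>
  The kernel of the homomorphism that \<open>f\<close> induces on the free group is a normal subgroup
  containing the relators, hence it contains their normal closure.
\<close>

lemma presented_group_universal:
  assumes "group H" and f: "f \<in> S \<rightarrow> carrier H" and R: "\<And>r. r \<in> R \<Longrightarrow> word_val H f r = \<one>\<^bsub>H\<^esub>"
  obtains h where "h \<in> hom (presented_group S R) H"
    and "\<And>w. w \<in> lists (UNIV \<times> S) \<Longrightarrow> h (pres_class S R w) = word_val H f w"
proof -
  obtain k where k: "k \<in> hom (free_group S) H"
    "\<And>w. w \<in> lists (UNIV \<times> S) \<Longrightarrow> k (word_equiv S `` {w}) = word_val H f w"
    using free_group_universal[OF assms(1) f] by blast
  interpret group_hom "free_group S" H k
    using assms(1) group_free_group k(1) by (simp add: group_hom_def group_hom_axioms_def)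
  have "(\<lambda>w. word_equiv S `` {w}) ` R \<subseteq> kernel (free_group S) H k"
  proof safe
    fix r assume "r \<in> R"
    then show "word_equiv S `` {r} \<in> kernel (free_group S) H k"
      using relators R k(2) class_in_free_group by (simp add: kernel_def subset_iff del: in_lists_conv_set)
  qed
  then have "N \<subseteq> kernel (free_group S) H k"
    using normal_kernel by (auto simp: normal_closure_def)
  then obtain h where "h \<in> hom (presented_group S R) H"
    "\<And>X. X \<in> carrier (free_group S) \<Longrightarrow> h (N #>\<^bsub>free_group S\<^esub> X) = k X"
    by (rule FactGroup_universal_kernel[OF normal_N, folded presented_group_def]) blast
  then show thesis using k(2) class_in_free_group that by (simp add: pres_class_def)
qed

end

section \<open>Products of arc weights along a walk\<close>

text \<open>
  Every pair of elements of the vertex type gets a weight. Together with the value \<open>\<one>\<close> on pairs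
  \<open>(x, x)\<close>, this makes the product along a walk meaningful for walks that pause at a vertex,
  and its laws hold for arbitrary words, walks or not.
\<close>

locale arc_weighting = group H for H (structure) +
  fixes g :: "'a \<Rightarrow> 'a \<Rightarrow> 'h"
  assumes weight_closed: "g x y \<in> carrier H"
    and weight_refl: "g x x = \<one>"
    and weight_sym: "g x y \<otimes> g y x = \<one>"
begin

fun walk_prod :: "'a list \<Rightarrow> 'h" where
  "walk_prod [] = \<one>"
| "walk_prod [x] = \<one>"
| "walk_prod (x # y # p) = g x y \<otimes> walk_prod (y # p)"

lemma walk_prod_closed: "walk_prod p \<in> carrier H"
  by (induction p rule: walk_prod.induct) (auto simp: weight_closed)

lemma walk_prod_append:
  assumes "p \<noteq> []" "q \<noteq> []"
  shows "walk_prod (p @ q) = walk_prod p \<otimes> (g (last p) (hd q) \<otimes> walk_prod q)"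
  using assms
proof (induction p rule: walk_prod.induct)
  case (2 x)
  then show ?case by (cases q) (auto simp: weight_closed walk_prod_closed)
next
  case (3 x y p)
  then show ?case by (simp add: m_assoc weight_closed walk_prod_closed)
qed simp

lemma walk_prod_join:
  assumes "p \<noteq> []" "q \<noteq> []" "last p = hd q"
  shows "walk_prod (p @ q) = walk_prod p \<otimes> walk_prod q"
  using assms by (simp add: walk_prod_append weight_refl walk_prod_closed)

lemma walk_prod_split: "walk_prod (p @ a # q) = walk_prod (p @ [a]) \<otimes> walk_prod (a # q)"
proof (cases q)
  case (Cons b q')
  then show ?thesis
    using walk_prod_append[of "p @ [a]" q] by simp
qed (simp add: walk_prod_closed)

lemma walk_prod_rev: "walk_prod p \<otimes> walk_prod (rev p) = \<one>"
proof (induction p rule: walk_prod.induct)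
  case (3 x y p)
  have "walk_prod (rev (x # y # p)) = walk_prod (rev (y # p)) \<otimes> g y x"
    using walk_prod_append[of "rev (y # p)" "[x]"] by (simp add: weight_closed)
  moreover have "g x y \<otimes> a \<otimes> (b \<otimes> g y x) = g x y \<otimes> (a \<otimes> b) \<otimes> g y x"
    if "a \<in> carrier H" "b \<in> carrier H" for a b
    using that by (simp add: m_assoc weight_closed)
  ultimately show ?case
    using 3 walk_prod_closed[of "y # p"] walk_prod_closed[of "rev (y # p)"]
    by (simp add: weight_closed weight_sym)
qed simp_all

text \<open>
  A part of a walk may be exchanged for another part with the same endpoints and the same product.
  The second endpoint \<open>a\<close> is written separately from \<open>u\<close> and \<open>w\<close> so that these may be empty,
  as happens when \<open>a, a\<close> is shortened to \<open>a\<close>.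
\<close>

lemma walk_prod_replace:
  assumes "walk_prod (u @ [a]) = walk_prod (w @ [a])" "hd (u @ [a]) = hd (w @ [a])"
  shows "walk_prod (p @ u @ a # q) = walk_prod (p @ w @ a # q)"
proof -
  have "walk_prod (p @ u @ [a]) = walk_prod (p @ w @ [a])"
    using assms walk_prod_append[of p "u @ [a]"] walk_prod_append[of p "w @ [a]"] by (cases "p = []") auto
  then show ?thesis
    using walk_prod_split[of "p @ u" a q] walk_prod_split[of "p @ w" a q] by simp
qed

text \<open>
  For the circuit transformation, the walk back from \<open>b\<close> to \<open>a\<close> along the reverse of \<open>ws\<close> is
  inverse both to the walk along \<open>vs\<close>, as the two together run around a circuit, and to the
  walk along \<open>ws\<close>, as this is the same walk in the other direction.
\<close>

lemma walk_prod_loop_step: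
  assumes circuits: "\<And>xs. circuit_in B xs \<Longrightarrow> walk_prod (xs @ [hd xs]) = \<one>"
    and "loop_step G B p q"
  shows "walk_prod p = walk_prod q"
  using assms(2)
proof cases
  case (circ a vs b ws p' q')
  let ?w = "b # rev ws @ [a]"
  have "walk_prod ((a # vs) @ b # rev ws @ [a]) = \<one>" using circuits[OF circ(3)] by simp
  then have "walk_prod (a # vs @ [b]) \<otimes> walk_prod ?w = \<one>"
    using walk_prod_split[of "a # vs" b "rev ws @ [a]"] by simp
  moreover have "walk_prod (a # ws @ [b]) \<otimes> walk_prod ?w = \<one>"
    using walk_prod_rev[of "a # ws @ [b]"] by simp
  ultimately have "walk_prod ((a # vs) @ [b]) = walk_prod ((a # ws) @ [b])"
    using walk_prod_closed by (metis append_Cons inv_equality inv_inv)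
  then show ?thesis
    using walk_prod_replace[of "a # vs" b "a # ws" p' q'] circ by simp
next
  case (backtrack a b p' q')
  then show ?thesis
    using walk_prod_replace[of "[a, b]" a "[]" p' q'] weight_sym weight_closed by simp
next
  case (stutter p' a q')
  then show ?thesis
    using walk_prod_replace[of "[a]" a "[]" p' q'] weight_refl by simp
qed

lemma walk_prod_equivclp:
  assumes circuits: "\<And>xs. circuit_in B xs \<Longrightarrow> walk_prod (xs @ [hd xs]) = \<one>"
    and "equivclp (loop_step G B) p q"
  shows "walk_prod p = walk_prod q"
  using assms(2)
  by (induction rule: equivclp_induct) (use walk_prod_loop_step[OF circuits] in metis)+

end

section \<open>Lazy walks\<close>

text \<open>
  Walks that may pause at a vertex; a based loop at \<open>v\<close> is one from \<open>v\<close> to \<open>v\<close>. Pausing allows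
  walks to be joined by plain concatenation \<open>p @ q\<close>, with the common vertex written
  twice, in place of the asymmetric \<open>p @ tl q\<close>.
\<close>

definition lazy_walk :: "'a pair_pre_digraph \<Rightarrow> 'a \<Rightarrow> 'a list \<Rightarrow> 'a \<Rightarrow> bool" where
  "lazy_walk G x p y \<longleftrightarrow> p \<noteq> [] \<and> set p \<subseteq> pverts G \<and> hd p = x \<and> last p = y \<and>
     successively (\<lambda>a b. a = b \<or> (a, b) \<in> parcs G) p"

lemma lazy_walk_append:
  assumes "lazy_walk G x p y" "lazy_walk G y q z" shows "lazy_walk G x (p @ q) z"
  using assms by (auto simp: lazy_walk_def successively_append_iff)

lemma lazy_walk_rev:
  assumes "pair_bidirected_digraph G" "lazy_walk G x p y" shows "lazy_walk G y (rev p) x"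
proof -
  have "successively (\<lambda>a b. b = a \<or> (b, a) \<in> parcs G) p"
    by (rule successively_mono[where P = "\<lambda>a b. a = b \<or> (a, b) \<in> parcs G"])
      (use assms(2) parcs_sym[OF assms(1)] in \<open>auto simp: lazy_walk_def\<close>)
  then show ?thesis using assms(2) by (simp add: lazy_walk_def hd_rev last_rev)
qed

lemma lazy_walk_subgraph:
  assumes "lazy_walk T x p y" "pverts T \<subseteq> pverts G" "parcs T \<subseteq> parcs G"
  shows "lazy_walk G x p y"
proof -
  have "successively (\<lambda>a b. a = b \<or> (a, b) \<in> parcs G) p"
    by (rule successively_mono[where P = "\<lambda>a b. a = b \<or> (a, b) \<in> parcs T"])
      (use assms in \<open>auto simp: lazy_walk_def\<close>)
  then show ?thesis using assms by (auto simp: lazy_walk_def)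
qed

lemma successively_iff_vwalk_arcs:
  "successively (\<lambda>a b. (a, b) \<in> E) p \<longleftrightarrow> set (vwalk_arcs p) \<subseteq> E"
  by (induction p rule: vwalk_arcs.induct) auto

lemma vwalk_iff_successively:
  "vwalk p (with_proj G) \<longleftrightarrow>
     p \<noteq> [] \<and> set p \<subseteq> pverts G \<and> successively (\<lambda>a b. (a, b) \<in> parcs G) p"
  by (auto simp: vwalk_def successively_iff_vwalk_arcs)

lemma vwalk_imp_lazy_walk:
  assumes "vwalk p (with_proj G)" shows "lazy_walk G (hd p) p (last p)"
proof -
  have "successively (\<lambda>a b. a = b \<or> (a, b) \<in> parcs G) p"
    by (rule successively_mono[where P = "\<lambda>a b. (a, b) \<in> parcs G"])
      (use assms in \<open>auto simp: vwalk_iff_successively\<close>)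
  then show ?thesis using assms by (auto simp: lazy_walk_def vwalk_iff_successively)
qed

lemma distinct_lazy_successively:
  assumes "distinct p" "successively (\<lambda>a b. a = b \<or> P a b) p" shows "successively P p"
  using assms by (induction p rule: induct_list012) auto

section \<open>Closed walks in a tree\<close>

text \<open>
  Look at a return to a vertex such that the vertices in between are distinct. If there are none
  or just one of them, this is a repeated letter or a backtracking; otherwise it is a circuit,
  which \<open>T\<close> does not have. With the empty collection of circuits, the only reductions are those that
  make the word shorter.
\<close>

lemma repeated_vertex_reducible:
  assumes "\<nexists>xs. circuit T xs" "set p \<subseteq> pverts T" "\<not> distinct p"
    and "successively (\<lambda>a b. a = b \<or> (a, b) \<in> parcs T) p"
  shows "\<exists>q. loop_step T {} p q"
  using assms(2-)
proof (induction p)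
  case (Cons a p)
  show ?case
  proof (cases "distinct p")
    case False
    then obtain q where "loop_step T {} p q"
      using Cons by (auto simp: successively_Cons)
    then show ?thesis using loop_step_append[of T "{}" p q "[a]" "[]"] by auto
  next
    case True
    then obtain m w where p: "p = m @ a # w" using Cons.prems by (auto dest: split_list)
    have succ: "successively (\<lambda>a b. a = b \<or> (a, b) \<in> parcs T) ((a # m) @ a # w)"
      using Cons.prems(3) p by simp
    have d: "distinct (a # m)" using True p by auto
    have strict: "successively (\<lambda>a b. (a, b) \<in> parcs T) (a # m)"
      by (rule distinct_lazy_successively[OF d]) (use succ successively_append_iff in blast)
    show ?thesis
    proof (cases m)
      case Nil
      then show ?thesis using loop_step.stutter[of T "{}" "[]" a w] p by auto
    next
      case m: (Cons b m')
      have last: "last m \<noteq> a" using d m last_in_set[of m] by (auto split: if_splits)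
      show ?thesis
      proof (cases m')
        case Nil
        then have "(a, b) \<in> parcs T" using strict m by simp
        then show ?thesis using loop_step.backtrack[of a b T "{}" "[]" w] p m Nil by auto
      next
        case (Cons c m'')
        have "(last m, a) \<in> parcs T"
          using succ last m unfolding successively_append_iff by simp
        then have "successively (\<lambda>a b. (a, b) \<in> parcs T) ((a # m) @ [a])"
          using strict m by (subst successively_append_iff) simp
        then have "circuit T (a # m)"
          unfolding circuit_def vwalk_iff_successively
          using d Cons.prems(1) p m Cons by auto
        then show ?thesis using assms(1) by blast
      qed
    qed
  qed
qed simp

lemma loop_step_lazy_walk:
  assumes "loop_step T {} p q" "lazy_walk T x p y"
  shows "length q < length p \<and> lazy_walk T x q y"
  using assms(1)
proof cases
  case (circ a vs b ws p' q')
  then show ?thesis by (simp add: circuit_in_def)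
next
  case (backtrack a b p' q')
  then show ?thesis using assms(2)
    by (cases q') (auto simp: lazy_walk_def successively_append_iff hd_append split: if_splits)
next
  case (stutter p' a q')
  then show ?thesis using assms(2)
    by (cases q') (auto simp: lazy_walk_def successively_append_iff hd_append split: if_splits)
qed

text \<open>
  By induction on the length: a closed walk with more than one letter repeats its first
  vertex, so it can be shortened.
\<close>

lemma closed_tree_walk_null:
  assumes "\<nexists>xs. circuit T xs" and "lazy_walk T x p x"
  shows "equivclp (loop_step T {}) p [x]"
  using assms(2)
proof (induction p rule: length_induct)
  case (1 p)
  show ?case
  proof (cases "distinct p")
    case True
    then have "p = [x]" using 1(2)
      by (cases p) (auto simp: lazy_walk_def split: if_splits)
    then show ?thesis by simp
  next
    case False
    then obtain q where q: "loop_step T {} p q"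
      using repeated_vertex_reducible[OF assms(1)] 1(2) by (auto simp: lazy_walk_def)
    then have "equivclp (loop_step T {}) q [x]"
      using 1 loop_step_lazy_walk by metis
    then show ?thesis using equivclp_trans[OF r_into_equivclp[where r = "loop_step T {}", OF q]] by blast
  qed
qed

lemma loop_step_mono:
  assumes "loop_step T {} p q" "parcs T \<subseteq> parcs G" shows "loop_step G B p q"
  using assms(1)
proof cases
  case (circ a vs b ws p' q')
  then show ?thesis by (simp add: circuit_in_def)
next
  case (backtrack a b p' q')
  then show ?thesis using loop_step.backtrack[of a b G B p' q'] assms(2) by auto
next
  case (stutter p' a q')
  then show ?thesis using loop_step.stutter[of G B p' a q'] by simp
qed

section \<open>Calculating with homotopic walks\<close>

lemma homotopic_append:
  assumes "equivclp (loop_step G B) p q"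
  shows "equivclp (loop_step G B) (u @ p @ w) (u @ q @ w)"
  by (rule equivclp_lift[OF assms]) (rule loop_step_append)

lemma homotopic_stutter: "equivclp (loop_step G B) (p @ x # x # q) (p @ x # q)"
  using loop_step.stutter[of G B p x q] by auto

lemma homotopic_join:
  assumes "p \<noteq> []" "q \<noteq> []" "last p = hd q"
  shows "equivclp (loop_step G B) (p @ q) (p @ tl q)"
proof -
  have "p @ q = butlast p @ hd q # hd q # tl q" "p @ tl q = butlast p @ hd q # tl q"
    using assms append_butlast_last_id[of p] hd_Cons_tl[of q]
    by (metis append.assoc append_Cons append_Nil)+
  then show ?thesis using homotopic_stutter by metis
qed

lemma homotopic_rev_cancel:
  assumes "pair_bidirected_digraph G" "lazy_walk G x p y"
  shows "equivclp (loop_step G B) (rev p @ p) [y]"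
proof -
  have "equivclp (loop_step G B) (rev p @ p) (rev p @ tl p)"
    by (rule homotopic_join) (use assms in \<open>auto simp: lazy_walk_def last_rev\<close>)
  also have "equivclp (loop_step G B) \<dots> [y]"
    using equivclp_rev_walk[OF assms(1), of p B] assms(2) by (simp add: lazy_walk_def)
  finally (equivclp_trans) show ?thesis .
qed

text \<open>
  Exchange the long way from the first vertex \<open>a\<close> to the last vertex \<open>b\<close> of the circuit for the
  arc \<open>ab\<close>; what remains is the backtracking \<open>a, b, a\<close>.
\<close>

lemma homotopic_circuit:
  assumes "pair_bidirected_digraph G" "circuit G xs" "circuit_in B xs"
  shows "equivclp (loop_step G B) (xs @ [hd xs]) [hd xs]"
proof -
  obtain a ys where ys: "xs = a # ys" "ys \<noteq> []"
    using assms(2) by (cases xs; cases "tl xs") (auto simp: circuit_def)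
  obtain vs b where vs: "ys = vs @ [b]"
    using ys(2) by (cases ys rule: rev_cases) auto
  have xs: "xs = a # vs @ [b]" using ys vs by simp
  have "successively (\<lambda>a b. (a, b) \<in> parcs G) ((a # vs) @ [b, a])"
    using assms(2) by (simp add: xs circuit_def vwalk_iff_successively)
  then have arc: "(b, a) \<in> parcs G"
    by (subst (asm) successively_append_iff) simp
  have "loop_step G B ([] @ a # vs @ b # [a]) ([] @ a # [] @ b # [a])"
    by (rule loop_step.circ) (use assms(3) xs in simp)
  moreover have "loop_step G B ([] @ [a, b, a] @ []) ([] @ [a] @ [])"
    using loop_step.backtrack parcs_sym[OF assms(1) arc] .
  ultimately show ?thesis
    using equivclp_trans[OF r_into_equivclp r_into_equivclp] by (simp add: xs)
qed

section \<open>Lassos: turning walks into loops\<close>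

locale graph_with_spanning_tree =
  fixes G T :: "'a pair_pre_digraph" and B :: "'a list set" and v :: 'a
  assumes bidirected: "pair_bidirected_digraph G"
    and circuits: "\<forall>xs\<in>B. circuit G xs"
    and base: "v \<in> pverts G"
    and tree: "undirected_spanning_tree T G"
begin

abbreviation homotopic (infix \<open>\<simeq>\<close> 50) where "p \<simeq> q \<equiv> equivclp (loop_step G B) p q"
abbreviation "loop_class p \<equiv> loop_equiv G B v `` {p}"
abbreviation "\<pi> \<equiv> pi1 G B v"
abbreviation "\<Gamma> \<equiv> Gamma G T B"
abbreviation "arc_word p \<equiv> map (Pair True) (vwalk_arcs p)"
abbreviation "word_class \<equiv> pres_class (parcs G) (Gamma_relators G T B)"

lemma bidirected_T: "pair_bidirected_digraph T"
  and connected_T: "Digraph_Component.connected (with_proj T)"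
  and circuit_free_T: "\<nexists>xs. circuit T xs"
  and pverts_T: "pverts T = pverts G"
  and parcs_T: "parcs T \<subseteq> parcs G"
  using tree by (auto simp: undirected_spanning_tree_def spanning_def subgraph_def)

lemma arc_verts: "(x, y) \<in> parcs G \<Longrightarrow> x \<in> pverts G \<and> y \<in> pverts G"
  using bidirected pair_wf_digraph.in_arcsD1 pair_wf_digraph.in_arcsD2
  by (metis pair_bidirected_digraph.axioms(2) pair_loopfree_digraph.axioms(1))

lemma group_\<pi>: "group \<pi>"
  by (rule group_pi1[OF bidirected base])

lemma group_\<Gamma>: "group \<Gamma>"
  by (rule group_Gamma[OF bidirected circuits tree])

sublocale presentation "parcs G" "Gamma_relators G T B"
proof
  have "set (vwalk_arcs (xs @ [hd xs])) \<subseteq> parcs G" if "circuit_in B xs" for xs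
    using circuit_circuit_in[OF bidirected circuits that] by (simp add: circuit_def vwalk_def)
  then show "Gamma_relators G T B \<subseteq> lists (UNIV \<times> parcs G)"
    using parcs_sym[OF bidirected] parcs_T by (fastforce simp: Gamma_relators_def)
qed

lemmas word_class_mult = pres_class_mult[folded Gamma_def]
  and word_class_Nil = pres_class_Nil[folded Gamma_def]
  and word_class_relator = pres_class_relator[folded Gamma_def]
  and carrier_\<Gamma> = carrier_presented_group[folded Gamma_def]
  and hom_word_class = hom_pres_class[folded Gamma_def]
  and \<Gamma>_universal = presented_group_universal[folded Gamma_def]

definition tree_walk :: "'a \<Rightarrow> 'a list" where
  "tree_walk x = (SOME p. lazy_walk T v p x)"

lemma tree_walk_T:
  assumes "x \<in> pverts G" shows "lazy_walk T v (tree_walk x) x"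
proof -
  interpret T: pair_bidirected_digraph T by (rule bidirected_T)
  have "symmetric (with_proj T)" by (rule T.sym_arcs)
  then have "strongly_connected (with_proj T)"
    using T.symmetric_connected_imp_strongly_connected connected_T by blast
  then have "v \<rightarrow>\<^sup>*\<^bsub>with_proj T\<^esub> x"
    using assms base by (simp add: strongly_connected_def pverts_T)
  then obtain p where "vwalk p (with_proj T)" "hd p = v" "last p = x"
    using T.reachable_vwalk_conv by blast
  then have "lazy_walk T v p x" using vwalk_imp_lazy_walk by metis
  then show ?thesis unfolding tree_walk_def by (rule someI)
qed

lemma tree_walk_G: "x \<in> pverts G \<Longrightarrow> lazy_walk G v (tree_walk x) x"
  using lazy_walk_subgraph[OF tree_walk_T] pverts_T parcs_T by simp

definition lasso :: "'a list \<Rightarrow> 'a list" where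
  "lasso p = tree_walk (hd p) @ p @ rev (tree_walk (last p))"

lemma lazy_walk_ends:
  assumes "lazy_walk G x p y"
  shows "p \<noteq> []" "hd p = x" "last p = y" "x \<in> pverts G" "y \<in> pverts G"
  using assms hd_in_set[of p] last_in_set[of p] by (auto simp: lazy_walk_def)

lemma lasso_based:
  assumes "lazy_walk G x p y" shows "lasso p \<in> based_loops G v"
proof -
  note e = lazy_walk_ends[OF assms]
  have "lazy_walk G v (tree_walk x @ p @ rev (tree_walk y)) v"
    by (rule lazy_walk_append[OF tree_walk_G[OF e(4)]
          lazy_walk_append[OF assms lazy_walk_rev[OF bidirected tree_walk_G[OF e(5)]]]])
  then show ?thesis by (simp add: lasso_def e(2,3) based_loops_def lazy_walk_def)
qed

lemma loop_class_eqI: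
  "p \<in> based_loops G v \<Longrightarrow> q \<in> based_loops G v \<Longrightarrow> p \<simeq> q \<Longrightarrow> loop_class p = loop_class q"
  by (rule equiv_class_eq[OF equiv_loop_equiv]) (simp add: loop_equiv_def)

lemma carrier_\<pi>: "carrier \<pi> = loop_class ` based_loops G v"
  by (auto simp: pi1_def quotient_def)

lemma trivial_loop: "[v] \<in> based_loops G v"
  using base by (simp add: based_loops_def)

lemma one_\<pi>: "\<one>\<^bsub>\<pi>\<^esub> = loop_class [v]"
  by (simp add: pi1_def)

lemma closed_tree_walk_homotopic:
  assumes "lazy_walk T x p x" shows "p \<simeq> [x]"
  using equivclp_lift[of "loop_step T {}" p "[x]" "loop_step G B" "\<lambda>p. p"]
    closed_tree_walk_null[OF circuit_free_T assms] loop_step_mono[OF _ parcs_T] by blast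

lemma lasso_tree:
  assumes "lazy_walk T x p y" shows "loop_class (lasso p) = \<one>\<^bsub>\<pi>\<^esub>"
proof -
  have G: "lazy_walk G x p y" using lazy_walk_subgraph[OF assms] pverts_T parcs_T by simp
  note e = lazy_walk_ends[OF G]
  have "lazy_walk T v (lasso p) v"
    unfolding lasso_def e(2,3)
    by (rule lazy_walk_append[OF tree_walk_T[OF e(4)]
          lazy_walk_append[OF assms lazy_walk_rev[OF bidirected_T tree_walk_T[OF e(5)]]]])
  then have "lasso p \<simeq> [v]" by (rule closed_tree_walk_homotopic)
  then show ?thesis
    unfolding one_\<pi> by (intro loop_class_eqI lasso_based[OF G] trivial_loop)
qed

lemma lasso_homotopic:
  assumes "p \<simeq> q" "lazy_walk G x p y" "lazy_walk G x q y"
  shows "loop_class (lasso p) = loop_class (lasso q)"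
proof (rule loop_class_eqI[OF lasso_based[OF assms(2)] lasso_based[OF assms(3)]])
  show "lasso p \<simeq> lasso q"
    using homotopic_append[OF assms(1)] lazy_walk_ends[OF assms(2)] lazy_walk_ends[OF assms(3)]
    by (simp add: lasso_def)
qed

text \<open>
  Both factors pass along the tree walk to \<open>y\<close>, the first on its way back to \<open>v\<close> and the second on
  its way out. These passages cancel in the concatenation.
\<close>

lemma lasso_Cons:
  assumes "lazy_walk G x (x # y # p) z"
  shows "loop_class (lasso [x, y]) \<otimes>\<^bsub>\<pi>\<^esub> loop_class (lasso (y # p)) = loop_class (lasso (x # y # p))"
proof -
  note e = lazy_walk_ends[OF assms]
  have xy: "lazy_walk G x [x, y] y" and yp: "lazy_walk G y (y # p) z"
    using assms by (auto simp: lazy_walk_def)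
  have y: "y \<in> pverts G" using lazy_walk_ends[OF xy] by simp
  have ty: "lazy_walk G v (tree_walk y) y" by (rule tree_walk_G[OF y])
  let ?t = "tree_walk y" and ?l = "tree_walk x @ [x]" and ?r = "p @ rev (tree_walk z)"
  have l1: "lasso [x, y] = ?l @ [y] @ rev ?t" and l2: "lasso (y # p) = ?t @ y # ?r"
    and l3: "lasso (x # y # p) = ?l @ y # ?r"
    using lazy_walk_ends(3)[OF yp] by (simp_all add: lasso_def)
  note b = lasso_based[OF xy] lasso_based[OF yp]
  have "lasso [x, y] @ tl (lasso (y # p)) \<simeq> lasso [x, y] @ lasso (y # p)"
    by (rule equivclp_sym, rule homotopic_join) (use b in \<open>auto simp: based_loops_def\<close>)
  also have "lasso [x, y] @ lasso (y # p) = (?l @ [y]) @ (rev ?t @ ?t) @ (y # ?r)"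
    unfolding l1 l2 by simp
  also have "\<dots> \<simeq> (?l @ [y]) @ [y] @ (y # ?r)"
    by (rule homotopic_append[OF homotopic_rev_cancel[OF bidirected ty]])
  also (equivclp_trans) have "\<dots> \<simeq> ?l @ y # y # ?r"
    using homotopic_stutter[of G B ?l y "y # ?r"] by simp
  also (equivclp_trans) have "\<dots> \<simeq> ?l @ y # ?r"
    by (rule homotopic_stutter)
  finally (equivclp_trans) have "lasso [x, y] @ tl (lasso (y # p)) \<simeq> lasso (x # y # p)"
    unfolding l3 .
  then show ?thesis
    unfolding pi1_mult[OF b]
    by (intro loop_class_eqI based_loops_concat b lasso_based[OF assms])
qed

section \<open>From the presentation to loops\<close>

abbreviation arc_class :: "'a \<times> 'a \<Rightarrow> 'a list set" where
  "arc_class a \<equiv> loop_class (lasso [fst a, snd a])"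

lemma arc_class_closed: "arc_class \<in> parcs G \<rightarrow> carrier \<pi>"
proof
  fix a assume "a \<in> parcs G"
  then have "lazy_walk G (fst a) [fst a, snd a] (snd a)"
    using arc_verts[of "fst a" "snd a"] by (simp add: lazy_walk_def)
  then show "arc_class a \<in> carrier \<pi>"
    using lasso_based by (simp add: carrier_\<pi>)
qed

lemma word_val_arc_word:
  assumes "vwalk p (with_proj G)"
  shows "word_val \<pi> arc_class (arc_word p) = loop_class (lasso p)"
  using assms
proof (induction p rule: vwalk_arcs.induct)
  case (2 x)
  then have "lazy_walk T x [x] x" by (simp add: lazy_walk_def vwalk_def pverts_T)
  then show ?case using lasso_tree by simp
next
  case (3 x y p)
  have "vwalk (y # p) (with_proj G)" using "3.prems" by (auto simp: vwalk_def)
  then show ?case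
    using "3.IH" lasso_Cons[of x y p] vwalk_imp_lazy_walk[OF "3.prems"] by simp
qed (simp add: vwalk_def)

text \<open>
  Every relator is the arc word of a walk. Those of the first and third kind belong to closed walks
  that contract to a vertex, and the lasso of a single vertex lies in the tree; those of the
  second kind belong to walks that lie in the tree themselves.
\<close>

lemma relator_val:
  assumes "r \<in> Gamma_relators G T B" shows "word_val \<pi> arc_class r = \<one>\<^bsub>\<pi>\<^esub>"
proof -
  have null: "word_val \<pi> arc_class (arc_word p) = \<one>\<^bsub>\<pi>\<^esub>"
    if p: "vwalk p (with_proj G)" "p \<simeq> [hd p]" "last p = hd p" for p
  proof -
    note G = vwalk_imp_lazy_walk[OF p(1), unfolded p(3)]
    have x: "lazy_walk T (hd p) [hd p] (hd p)"
      using lazy_walk_ends(4)[OF G] by (simp add: lazy_walk_def pverts_T)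
    then have "loop_class (lasso p) = loop_class (lasso [hd p])"
      using lazy_walk_subgraph[OF x, of G] pverts_T parcs_T
      by (intro lasso_homotopic[OF p(2) G]) simp
    then show ?thesis using word_val_arc_word[OF p(1)] lasso_tree[OF x] by simp
  qed
  from assms consider
      x y where "r = arc_word [x, y, x]" "(x, y) \<in> parcs G"
    | x y where "r = arc_word [x, y]" "(x, y) \<in> parcs T"
    | xs where "r = arc_word (xs @ [hd xs])" "circuit_in B xs"
    by (fastforce simp: Gamma_relators_def)
  then show ?thesis
  proof cases
    case (1 x y)
    have "[x, y, x] \<simeq> [x]"
      using loop_step.backtrack[OF 1(2), of B "[]" "[]"] by auto
    moreover have "vwalk [x, y, x] (with_proj G)"
      using 1(2) arc_verts parcs_sym[OF bidirected] by (auto simp: vwalk_iff_successively)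
    ultimately show ?thesis unfolding 1(1) by (intro null) simp_all
  next
    case (2 x y)
    have G: "(x, y) \<in> parcs G" using 2 parcs_T by blast
    then have w: "vwalk [x, y] (with_proj G)" "lazy_walk T x [x, y] y"
      using arc_verts 2 by (auto simp: vwalk_iff_successively lazy_walk_def pverts_T)
    show ?thesis unfolding 2(1) by (rule trans[OF word_val_arc_word[OF w(1)] lasso_tree[OF w(2)]])
  next
    case (3 xs)
    have c: "circuit G xs" by (rule circuit_circuit_in[OF bidirected circuits 3(2)])
    then have "xs \<noteq> []" by (auto simp: circuit_def)
    then show ?thesis
      using c homotopic_circuit[OF bidirected c 3(2)]
      unfolding 3(1) by (intro null) (auto simp: circuit_def)
  qed
qed

section \<open>From loops to the presentation\<close>

text \<open>
  The value \<open>\<one>\<close> away from the arcs covers the pauses of a walk and keeps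
  \<open>weight x y \<otimes> weight y x = \<one>\<close> true for all pairs.
\<close>

definition weight :: "'a \<Rightarrow> 'a \<Rightarrow> ('a \<times> 'a) word set set" where
  "weight x y = (if (x, y) \<in> parcs G then word_class [(True, (x, y))] else \<one>\<^bsub>\<Gamma>\<^esub>)"

lemma weight_arc: "(x, y) \<in> parcs G \<Longrightarrow> weight x y = word_class [(True, (x, y))]"
  by (simp add: weight_def)

sublocale arc_weighting \<Gamma> weight
proof (intro arc_weighting.intro arc_weighting_axioms.intro group_\<Gamma>)
  interpret \<Gamma>: group \<Gamma> by (rule group_\<Gamma>)
  show "weight x y \<in> carrier \<Gamma>" for x y
    using \<Gamma>.one_closed by (auto simp: weight_def carrier_\<Gamma>)
  show "weight x x = \<one>\<^bsub>\<Gamma>\<^esub>" for x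
    using pair_loopfree_digraph.pair_no_loops[OF pair_bidirected_digraph.axioms(2)[OF bidirected],
        of "(x, x)"]
    by (auto simp: weight_def)
  show "weight x y \<otimes>\<^bsub>\<Gamma>\<^esub> weight y x = \<one>\<^bsub>\<Gamma>\<^esub>" for x y
  proof (cases "(x, y) \<in> parcs G")
    case True
    then have yx: "(y, x) \<in> parcs G" by (rule parcs_sym[OF bidirected])
    have "[(True, (x, y)), (True, (y, x))] \<in> Gamma_relators G T B"
      using True by (auto simp: Gamma_relators_def)
    then show ?thesis
      using word_class_mult[of "[(True, (x, y))]" "[(True, (y, x))]"] word_class_relator True yx
      by (simp add: weight_def)
  next
    case False
    then have "(y, x) \<notin> parcs G" using parcs_sym[OF bidirected] by blast
    then show ?thesis using False by (simp add: weight_def)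
  qed
qed

lemma walk_prod_arc_word:
  assumes "vwalk p (with_proj G)" shows "walk_prod p = word_class (arc_word p)"
  using assms
proof (induction p rule: vwalk_arcs.induct)
  case (3 x y p)
  have y: "vwalk (y # p) (with_proj G)" and xy: "(x, y) \<in> parcs G"
    using "3.prems" by (auto simp: vwalk_def)
  have "arc_word (y # p) \<in> lists (UNIV \<times> parcs G)" using y by (auto simp: vwalk_def)
  then show ?case
    using "3.IH"[OF y] xy word_class_mult[of "[(True, (x, y))]" "arc_word (y # p)"]
    by (simp add: weight_arc)
qed (simp_all add: word_class_Nil)

lemma walk_prod_homotopic:
  assumes "p \<simeq> q" shows "walk_prod p = walk_prod q"
proof (rule walk_prod_equivclp[OF _ assms])
  fix xs assume xs: "circuit_in B xs"
  have "arc_word (xs @ [hd xs]) \<in> Gamma_relators G T B"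
    using xs by (auto simp: Gamma_relators_def)
  moreover have "vwalk (xs @ [hd xs]) (with_proj G)"
    using circuit_circuit_in[OF bidirected circuits xs] by (simp add: circuit_def)
  ultimately show "walk_prod (xs @ [hd xs]) = \<one>\<^bsub>\<Gamma>\<^esub>"
    by (simp add: walk_prod_arc_word word_class_relator)
qed

lemma walk_prod_tree:
  assumes "lazy_walk T x p y" shows "walk_prod p = \<one>\<^bsub>\<Gamma>\<^esub>"
proof -
  interpret \<Gamma>: group \<Gamma> by (rule group_\<Gamma>)
  have T: "weight a b = \<one>\<^bsub>\<Gamma>\<^esub>" if "a = b \<or> (a, b) \<in> parcs T" for a b
  proof -
    have "weight a b = \<one>\<^bsub>\<Gamma>\<^esub>" if "(a, b) \<in> parcs T"
    proof -
      have "[(True, (a, b))] \<in> Gamma_relators G T B" using that by (auto simp: Gamma_relators_def)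
      then show ?thesis using that parcs_T weight_arc word_class_relator by auto
    qed
    then show ?thesis using that weight_refl by blast
  qed
  have "successively (\<lambda>a b. a = b \<or> (a, b) \<in> parcs T) p" using assms by (simp add: lazy_walk_def)
  then show ?thesis
    by (induction p rule: walk_prod.induct) (simp_all add: T)
qed

lemma walk_prod_lasso:
  assumes "(x, y) \<in> parcs G" shows "walk_prod (lasso [x, y]) = word_class [(True, (x, y))]"
proof -
  interpret \<Gamma>: group \<Gamma> by (rule group_\<Gamma>)
  have xy: "x \<in> pverts G" "y \<in> pverts G" using arc_verts[OF assms] by auto
  note x = tree_walk_T[OF xy(1)] and y = lazy_walk_rev[OF bidirected_T tree_walk_T[OF xy(2)]]
  have "walk_prod (lasso [x, y]) = walk_prod (tree_walk x) \<otimes>\<^bsub>\<Gamma>\<^esub> walk_prod ([x, y] @ rev (tree_walk y))"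
    unfolding lasso_def by (subst walk_prod_join) (use x in \<open>auto simp: lazy_walk_def\<close>)
  also have "walk_prod ([x, y] @ rev (tree_walk y)) = walk_prod [x, y] \<otimes>\<^bsub>\<Gamma>\<^esub> walk_prod (rev (tree_walk y))"
    by (rule walk_prod_join) (use y in \<open>auto simp: lazy_walk_def\<close>)
  finally show ?thesis
    using walk_prod_tree[OF x] walk_prod_tree[OF y] weight_closed[of x y] assms
    by (simp add: weight_arc)
qed

lemma loop_word_hom:
  obtains \<psi> where "\<psi> \<in> hom \<pi> \<Gamma>" and "\<And>p. p \<in> based_loops G v \<Longrightarrow> \<psi> (loop_class p) = walk_prod p"
proof -
  define \<psi> where "\<psi> X = walk_prod (SOME p. p \<in> X)" for X
  have \<psi>: "\<psi> (loop_class p) = walk_prod p" if p: "p \<in> based_loops G v" for p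
  proof -
    have "p \<in> loop_class p" using equiv_class_self[OF equiv_loop_equiv p] .
    then have "(SOME q. q \<in> loop_class p) \<in> loop_class p" by (rule someI)
    then have "p \<simeq> (SOME q. q \<in> loop_class p)" unfolding loop_equiv_def by blast
    then show ?thesis unfolding \<psi>_def by (rule walk_prod_homotopic[symmetric])
  qed
  have "\<psi> \<in> hom \<pi> \<Gamma>"
  proof (rule homI)
    show "\<psi> X \<in> carrier \<Gamma>" if "X \<in> carrier \<pi>" for X
      using that \<psi> walk_prod_closed by (auto simp: carrier_\<pi>)
    fix X Y assume "X \<in> carrier \<pi>" "Y \<in> carrier \<pi>"
    then obtain p q where p: "p \<in> based_loops G v" "X = loop_class p"
      and q: "q \<in> based_loops G v" "Y = loop_class q" by (auto simp: carrier_\<pi>)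
    have ends: "p \<noteq> []" "q \<noteq> []" "last p = hd q" using p q by (auto simp: based_loops_def)
    have "walk_prod (p @ tl q) = walk_prod (p @ q)"
      by (rule walk_prod_homotopic[OF homotopic_join[OF ends], symmetric])
    also have "\<dots> = walk_prod p \<otimes>\<^bsub>\<Gamma>\<^esub> walk_prod q" by (rule walk_prod_join[OF ends])
    finally show "\<psi> (X \<otimes>\<^bsub>\<pi>\<^esub> Y) = \<psi> X \<otimes>\<^bsub>\<Gamma>\<^esub> \<psi> Y"
      using p q by (simp add: pi1_mult \<psi> based_loops_concat)
  qed
  then show thesis using \<psi> that by blast
qed

section \<open>The isomorphism\<close>

text \<open>
  A homomorphism that turns each arc into its lasso does the same with the product along any walk.
  Pauses fit in because their weight is trivial and their lasso lies in the tree.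
\<close>

lemma hom_walk_prod:
  assumes h: "h \<in> hom \<Gamma> \<pi>" "\<And>a. a \<in> parcs G \<Longrightarrow> h (word_class [(True, a)]) = arc_class a"
    and p: "lazy_walk G x p y"
  shows "h (walk_prod p) = loop_class (lasso p)"
  using p
proof (induction p arbitrary: x rule: walk_prod.induct)
  case (2 z)
  interpret group_hom \<Gamma> \<pi> h
    using group_\<Gamma> group_\<pi> h(1) by (simp add: group_hom_def group_hom_axioms_def)
  have "lazy_walk T z [z] z" using 2 by (auto simp: lazy_walk_def pverts_T)
  then show ?case using lasso_tree by simp
next
  case (3 z w p)
  interpret group_hom \<Gamma> \<pi> h
    using group_\<Gamma> group_\<pi> h(1) by (simp add: group_hom_def group_hom_axioms_def)
  have walk: "lazy_walk G z (z # w # p) y" "lazy_walk G w (w # p) y"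
    using "3.prems" by (auto simp: lazy_walk_def)
  have "h (weight z w) = loop_class (lasso [z, w])"
  proof (cases "(z, w) \<in> parcs G")
    case True
    then show ?thesis using h(2) by (simp add: weight_def)
  next
    case False
    then have "lazy_walk T z [z, w] w" using walk(1) by (simp add: lazy_walk_def pverts_T)
    then show ?thesis using False lasso_tree by (simp add: weight_def)
  qed
  then show ?case
    using "3.IH"[OF walk(2)] lasso_Cons[OF walk(1)] by (simp add: weight_closed walk_prod_closed)
qed (simp add: lazy_walk_def)

text \<open>
  The tree walk chosen for \<open>v\<close> need not be \<open>[v]\<close>, but it is closed and hence contracts to \<open>[v]\<close>.
\<close>

lemma lasso_loop:
  assumes "p \<in> based_loops G v" shows "loop_class (lasso p) = loop_class p"
proof -
  have G: "lazy_walk G v p v" using assms by (simp add: based_loops_def lazy_walk_def)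
  let ?t = "tree_walk v"
  obtain q where q: "p = v # q" using assms by (cases p) (auto simp: based_loops_def)
  obtain r where r: "p = r @ [v]" using assms by (cases p rule: rev_cases) (auto simp: based_loops_def)
  have t: "?t \<simeq> [v]" "rev ?t \<simeq> [v]"
    using closed_tree_walk_homotopic tree_walk_T[OF base] lazy_walk_rev[OF bidirected_T] by blast+
  have "lasso p = ?t @ p @ rev ?t" using lazy_walk_ends[OF G] by (simp add: lasso_def)
  then have "lasso p \<simeq> [v] @ p @ rev ?t"
    using homotopic_append[OF t(1), of "[]" "p @ rev ?t"] by simp
  also have "\<dots> \<simeq> p @ rev ?t"
    using homotopic_stutter[of G B "[]" v "q @ rev ?t"] by (simp add: q)
  also (equivclp_trans) have "\<dots> \<simeq> p @ [v]"
    using homotopic_append[OF t(2), of p "[]"] by simp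
  also (equivclp_trans) have "\<dots> \<simeq> p"
    using homotopic_stutter[of G B r v "[]"] by (simp add: r)
  finally (equivclp_trans) show ?thesis
    by (intro loop_class_eqI lasso_based[OF G] assms)
qed

lemma pi1_iso_Gamma: "\<pi> \<cong> \<Gamma>"
proof -
  obtain \<psi> where \<psi>: "\<psi> \<in> hom \<pi> \<Gamma>" "\<And>p. p \<in> based_loops G v \<Longrightarrow> \<psi> (loop_class p) = walk_prod p"
    using loop_word_hom by blast
  obtain \<phi> where \<phi>: "\<phi> \<in> hom \<Gamma> \<pi>"
    "\<And>w. w \<in> lists (UNIV \<times> parcs G) \<Longrightarrow> \<phi> (word_class w) = word_val \<pi> arc_class w"
    using \<Gamma>_universal[OF group_\<pi> arc_class_closed relator_val] by blast
  interpret \<pi>: group \<pi> by (rule group_\<pi>)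
  have arc: "\<phi> (word_class [(True, a)]) = arc_class a" if "a \<in> parcs G" for a
    using that \<phi>(2)[of "[(True, a)]"] arc_class_closed by (auto simp: Pi_iff)
  have "\<phi> (\<psi> X) = X" if X: "X \<in> carrier \<pi>" for X
  proof -
    obtain p where p: "p \<in> based_loops G v" "X = loop_class p"
      using X by (auto simp: carrier_\<pi>)
    then have "lazy_walk G v p v" by (simp add: based_loops_def lazy_walk_def)
    then show ?thesis
      using hom_walk_prod[OF \<phi>(1) arc] lasso_loop p \<psi>(2) by simp
  qed
  moreover have "\<psi> (\<phi> Y) = Y" if Y: "Y \<in> carrier \<Gamma>" for Y
  proof -
    obtain w where w: "w \<in> lists (UNIV \<times> parcs G)" "Y = word_class w"
      using Y carrier_\<Gamma> by auto
    \<comment> \<open>An endomorphism of \<open>\<Gamma>\<close> is determined by the generators, so it is enough to compare there.\<close>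
    have gen: "(\<psi> \<circ> \<phi>) (word_class [(True, a)]) = word_class [(True, a)]" if "a \<in> parcs G" for a
    proof -
      obtain x y where a: "a = (x, y)" by (cases a)
      have "lazy_walk G x [x, y] y" using that arc_verts by (auto simp: a lazy_walk_def)
      then have "\<psi> (arc_class a) = walk_prod (lasso [x, y])"
        using \<psi>(2)[OF lasso_based] by (simp add: a)
      then show ?thesis using arc[OF that] walk_prod_lasso that by (simp add: a)
    qed
    have "\<psi> \<circ> \<phi> \<in> hom \<Gamma> \<Gamma>"
      by (rule Group.hom_compose[OF \<phi>(1) \<psi>(1)])
    then have "(\<psi> \<circ> \<phi>) (word_class w) = word_val \<Gamma> (\<lambda>a. (\<psi> \<circ> \<phi>) (word_class [(True, a)])) w"
      by (rule hom_word_class[OF group_\<Gamma> _ w(1)])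
    also have "\<dots> = word_val \<Gamma> (\<lambda>a. word_class [(True, a)]) w"
      by (rule word_val_cong[OF gen w(1)])
    also have "\<dots> = word_class w"
      using hom_word_class[OF group_\<Gamma>, of "\<lambda>X. X", OF _ w(1)]
      by (simp add: hom_def Pi_iff)
    finally show ?thesis using w(2) by simp
  qed
  ultimately have "group_isomorphisms \<pi> \<Gamma> \<psi> \<phi>"
    using \<phi>(1) \<psi>(1) by (simp add: group_isomorphisms_def)
  then show ?thesis by (rule is_isoI[OF group_isomorphisms_imp_iso])
qed

end

theorem theorem7p2:
  fixes G :: "'a pair_pre_digraph" and B :: "'a list set" and v :: 'a
  assumes "pair_bidirected_digraph G"
    and "Digraph_Component.connected (with_proj G)"
    and "\<forall>xs\<in>B. circuit G xs"
    and "v \<in> pverts G"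
  shows "(\<forall>T. undirected_spanning_tree T G \<longrightarrow> pi1 G B v \<cong> Gamma G T B) \<and>
         (\<forall>T T'. undirected_spanning_tree T G \<and> undirected_spanning_tree T' G \<longrightarrow>
            Gamma G T B \<cong> Gamma G T' B)"
proof (intro conjI allI impI)
  show iso: "pi1 G B v \<cong> Gamma G T B" if "undirected_spanning_tree T G" for T
    by (intro graph_with_spanning_tree.pi1_iso_Gamma graph_with_spanning_tree.intro assms that)
  fix T T' assume "undirected_spanning_tree T G \<and> undirected_spanning_tree T' G"
  then have T: "undirected_spanning_tree T G" and T': "undirected_spanning_tree T' G" by auto
  have "Gamma G T B \<cong> pi1 G B v"
    using group.iso_sym[OF group_pi1[OF assms(1,4)] iso[OF T]] .
  also have "\<dots> \<cong> Gamma G T' B" by (rule iso[OF T'])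
  finally show "Gamma G T B \<cong> Gamma G T' B" .
qed

end
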